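(* Let $\lambda>0$, $V>0$, $\theta_{\mathrm{up}}>0$, let $F_\Theta$ be the cumulative distribution function of the uniform distribution on $[0,\theta_{\mathrm{up}}]$, and let $\mathbf{E}[T(p)]$, $p\in[0,1]$, be the mean queueing delay of the shared-use operator, as defined in the context. For a given admission price $c_1\ge 0$, there exists a unique Nash equilibrium $p_1^*\in[0,1]$ of the secondary users' joining probability in the shared-use monopoly market. That is, there is exactly one $p_1^*\in[0,1]$ with $$p_1^* = F_\Theta\bigl(\theta_1(p_1^* )\bigr),\qquad \theta_1(p)=\frac{V-c_1}{\mathbf{E}[T(p)]},$$ and at this $p_1^*$ no user of any type $\theta\in[0,\theta_{\mathrm{up}}]$ can increase its expected utility $p(\theta)\bigl(V-\theta\,\mathbf{E}[T(p_1^* )]-c_1\bigr)$ by choosing a joining probability in $[0,1]$ different from the individual optimal strategy ($p(\theta)=1$ if $\theta<\theta_1(p_1^* )$, and $p(\theta)=0$ otherwise).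
   Context: Secondary users (SUs) arrive according to a Poisson process of rate $\lambda>0$. Each SU carries a job with random service time $X>0$. Its type $\theta$ (delay sensitivity) is drawn from the uniform distribution on $[0,\theta_{\mathrm{up}}]$, with cumulative distribution function $F_\Theta$ (so $F_\Theta(x)=0$ for $x\le 0$, $F_\Theta(x)=x/\theta_{\mathrm{up}}$ on $[0,\theta_{\mathrm{up}}]$, and $F_\Theta(x)=1$ for $x\ge\theta_{\mathrm{up}}$). The shared-use operator has a single channel alternating between ON periods (i.i.d. copies $Y_i$ of $Y>0$, during which SU service is interrupted) and OFF periods (i.i.d. copies of $Z>0$), independent of SU arrivals and service times. The effective service time is $X_e=X+\sum_{i=1}^{N(X)}Y_i$, where $N(X)$ is the number of ON periods interrupting the service. One has $\mathbf{E}[X_e]=\mathbf{E}[X]\,(1+\mathbf{E}[Y]/\mathbf{E}[Z])$, and $\mathbf{E}[X_e]$, $\mathbf{E}[X_e^2]$ are positive and finite. If a fraction $p\in[0,1]$ of SUs joins, the mean queueing delay is given by the extended-value M/G/1 formula $$\mathbf{E}[T(p)]=\begin{cases}\dfrac{\lambda p\,\mathbf{E}[X_e^2]}{2(1-\lambda p\,\mathbf{E}[X_e])}+\mathbf{E}[X_e], & \lambda p<1/\mathbf{E}[X_e],\\[2mm] \infty, & \text{otherwise,}\end{cases}$$ with the convention $a/\infty=0$. A type-$\theta$ SU that joins gets utility $U_1(\theta)=V-\theta\,\mathbf{E}[T(p)]-c_1$, where $V$ is the service reward and $c_1$ is the admission price. Balking gives utility $0$. The individual optimal strategy is to join with probability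 $1$ if $U_1(\theta)>0$, i.e. $\theta<\theta_1(p)$, and with probability $0$ otherwise. A Nash equilibrium of the SUs' joining probability is a $p_1^*$ satisfying $p_1^*=F_\Theta(\theta_1(p_1^* ))$; at such a point no SU has an incentive to deviate from its strategy, assuming that all other SUs continue to follow theirs. *)

theory Defs
  imports "HOL-Probability.Probability"
begin

text \<open>Service of a job interrupted by ON periods. It progresses only during OFF periods:
  \<open>R\<close> is what remains of the OFF period in which service starts, followed by full OFF
  periods \<open>Z 0, Z 1, \<dots>\<close>. The interruption with index \<open>n\<close>, of length \<open>Y n\<close>, occurs once
  \<open>R + Z 0 + \<dots> + Z (n - 1)\<close> units of work are done, provided the job of size \<open>x\<close> is then
  still unfinished. The set counted is almost surely finite under the assumptions of the
  locale below.\<close>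

definition num_interruptions ::
    "('w \<Rightarrow> real) \<Rightarrow> (nat \<Rightarrow> 'w \<Rightarrow> real) \<Rightarrow> real \<Rightarrow> 'w \<Rightarrow> nat" where
  "num_interruptions R Z x \<omega> = card {n. R \<omega> + (\<Sum>i<n. Z i \<omega>) < x}"

definition effective_service_time ::
    "('w \<Rightarrow> real) \<Rightarrow> (nat \<Rightarrow> 'w \<Rightarrow> real) \<Rightarrow> ('w \<Rightarrow> real) \<Rightarrow> (nat \<Rightarrow> 'w \<Rightarrow> real) \<Rightarrow> 'w \<Rightarrow> real" where
  "effective_service_time X Y R Z \<omega> =
     X \<omega> + (\<Sum>i<num_interruptions R Z (X \<omega>) \<omega>. Y i \<omega>)"

text \<open>\<open>Y 0\<close> and \<open>Z 0\<close> serve as the generic ON and OFF period. The law of \<open>R\<close> is left open: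
  it may be that of \<open>Z 0\<close> (exponential OFF periods) or the stationary residual
  law; both are compatible with \<open>mean_effective\<close>.\<close>

locale shared_use_channel = prob_space M for M :: "'w measure" +
  fixes X :: "'w \<Rightarrow> real" and Y :: "nat \<Rightarrow> 'w \<Rightarrow> real"
    and R :: "'w \<Rightarrow> real" and Z :: "nat \<Rightarrow> 'w \<Rightarrow> real"
  assumes X_pos: "AE \<omega> in M. X \<omega> > 0"
    and Y_pos: "\<And>i. AE \<omega> in M. Y i \<omega> > 0"
    and R_pos: "AE \<omega> in M. R \<omega> > 0"
    and Z_pos: "\<And>i. AE \<omega> in M. Z i \<omega> > 0"
    and Y_indep: "indep_vars (\<lambda>_. borel) Y UNIV"
    and Y_ident: "\<And>i. distr M borel (Y i) = distr M borel (Y 0)"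
    and Z_indep: "indep_vars (\<lambda>_. borel) Z UNIV"
    and Z_ident: "\<And>i. distr M borel (Z i) = distr M borel (Z 0)"
    and R_measurable: "random_variable borel R"
    and service_channel_indep:
      "indep_set (sets (vimage_algebra (space M) X borel))
         (sets (vimage_algebra (space M) (\<lambda>\<omega>. (R \<omega>, ((\<lambda>i. Y i \<omega>), (\<lambda>i. Z i \<omega>))))
            (borel \<Otimes>\<^sub>M (PiM UNIV (\<lambda>_. borel) \<Otimes>\<^sub>M PiM UNIV (\<lambda>_. borel)))))"
    and X_integrable: "integrable M X"
    and Y_integrable: "integrable M (Y 0)"
    and Z_integrable: "integrable M (Z 0)"
    and Xe_integrable: "integrable M (effective_service_time X Y R Z)"
    and Xe_sq_integrable: "integrable M (\<lambda>\<omega>. (effective_service_time X Y R Z \<omega>)\<^sup>2)"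
    and Xe_mean_pos: "expectation (effective_service_time X Y R Z) > 0"
    and Xe_sq_mean_pos: "expectation (\<lambda>\<omega>. (effective_service_time X Y R Z \<omega>)\<^sup>2) > 0"
    and mean_effective:
      "expectation (effective_service_time X Y R Z) =
         expectation X * (1 + expectation (Y 0) / expectation (Z 0))"

definition mean_delay :: "'w measure \<Rightarrow> ('w \<Rightarrow> real) \<Rightarrow> real \<Rightarrow> real \<Rightarrow> ereal" where
  "mean_delay M S lam p =
     (if lam * p < 1 / integral\<^sup>L M S
      then ereal (lam * p * integral\<^sup>L M (\<lambda>\<omega>. (S \<omega>)\<^sup>2) / (2 * (1 - lam * p * integral\<^sup>L M S))
             + integral\<^sup>L M S)
      else \<infinity>)"

definition type_cdf :: "real \<Rightarrow> real \<Rightarrow> real" where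
  "type_cdf \<theta>up = cdf (uniform_measure lborel {0..\<theta>up})"

text \<open>In the definitions below \<open>T\<close> maps a joining probability of the population to the
  mean delay. Division of a real by \<open>\<infinity>\<close> is \<open>0\<close> on \<^typ>\<open>ereal\<close>, so the quotient in
  \<open>join_threshold\<close> is finite whenever the delay is positive.\<close>

definition join_threshold :: "real \<Rightarrow> real \<Rightarrow> (real \<Rightarrow> ereal) \<Rightarrow> real \<Rightarrow> real" where
  "join_threshold V c T p = real_of_ereal (ereal (V - c) / T p)"

definition join_utility :: "real \<Rightarrow> real \<Rightarrow> (real \<Rightarrow> ereal) \<Rightarrow> real \<Rightarrow> real \<Rightarrow> ereal" where
  "join_utility V c T p \<theta> = ereal V - ereal \<theta> * T p - ereal c"

definition expected_utility ::
    "real \<Rightarrow> real \<Rightarrow> (real \<Rightarrow> ereal) \<Rightarrow> real \<Rightarrow> real \<Rightarrow> real \<Rightarrow> ereal" where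
  "expected_utility V c T p \<theta> q = ereal q * join_utility V c T p \<theta>"

definition optimal_strategy :: "real \<Rightarrow> real \<Rightarrow> (real \<Rightarrow> ereal) \<Rightarrow> real \<Rightarrow> real \<Rightarrow> real" where
  "optimal_strategy V c T p \<theta> = (if \<theta> < join_threshold V c T p then 1 else 0)"

definition nash_equilibrium :: "real \<Rightarrow> real \<Rightarrow> real \<Rightarrow> (real \<Rightarrow> ereal) \<Rightarrow> real \<Rightarrow> bool" where
  "nash_equilibrium \<theta>up V c T p \<longleftrightarrow>
     p \<in> {0..1} \<and> p = type_cdf \<theta>up (join_threshold V c T p)"

end

theory Submission
  imports Defs
begin

text \<open>The best response \<open>p \<mapsto> F (\<theta>\<^sub>1 p)\<close> is continuous on \<open>[0, 1]\<close>, since the threshold tends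
  to \<open>0\<close> as \<open>p\<close> approaches the congestion level at which the delay becomes infinite, and it is
  nonincreasing, since the delay is nondecreasing. So \<open>p - F (\<theta>\<^sub>1 p)\<close> is strictly increasing and
  has a zero by the intermediate value theorem. At the zero the delay is finite: otherwise the
  threshold, and with it \<open>p\<close>, would be \<open>0\<close>, but the delay is finite at \<open>p = 0\<close>. With a finite
  delay the utility from joining is positive exactly below the threshold.\<close>

lemma type_cdf_eq:
  assumes "\<theta>up > 0"
  shows "type_cdf \<theta>up x = min 1 (max 0 (x / \<theta>up))"
proof -
  have "type_cdf \<theta>up x = measure lborel ({0..\<theta>up} \<inter> {..x}) / measure lborel {0..\<theta>up}"
    unfolding type_cdf_def cdf_def using assms by (intro measure_uniform_measure) auto
  also have "{0..\<theta>up} \<inter> {..x} = {0..min \<theta>up x}"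
    by auto
  also have "measure lborel {0..min \<theta>up x} / measure lborel {0..\<theta>up} = min 1 (max 0 (x / \<theta>up))"
    using assms by (auto simp: min_def max_def field_simps)
  finally show ?thesis .
qed

text \<open>The parameters stand for \<open>m = E[X\<^sub>e]\<close>, \<open>s = E[X\<^sub>e\<^sup>2]\<close> and \<open>a = 2 max(0, V - c) / \<theta>\<^sub>u\<^sub>p\<close>. Truncating
  at \<open>0\<close> covers the infinite delay, and the denominator does not vanish even there.\<close>

definition best_response :: "real \<Rightarrow> real \<Rightarrow> real \<Rightarrow> real \<Rightarrow> real \<Rightarrow> real" where
  "best_response lam m s a p =
     min 1 (a * max 0 (1 - lam * p * m) / (lam * p * s + 2 * m * max 0 (1 - lam * p * m)))"

text \<open>The two summands never vanish together: the first is zero only at \<open>p = 0\<close>,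
  where the second is \<open>2 * m\<close>.\<close>

lemma best_response_denominator_pos:
  fixes lam m s p :: real
  assumes "lam > 0" "m > 0" "s > 0" "p \<ge> 0"
  shows "lam * p * s + 2 * m * max 0 (1 - lam * p * m) > 0"
proof (cases "p = 0")
  case True
  then show ?thesis using assms by simp
next
  case False
  then have "lam * p * s > 0" using assms by simp
  moreover have "2 * m * max 0 (1 - lam * p * m) \<ge> 0" using assms by simp
  ultimately show ?thesis by linarith
qed

lemma continuous_on_best_response:
  assumes "lam > 0" "m > 0" "s > 0"
  shows "continuous_on {0..1} (best_response lam m s a)"
  unfolding best_response_def using best_response_denominator_pos[OF assms]
  by (intro continuous_intros) (metis atLeastAtMost_iff less_irrefl)

lemma best_response_antimono:
  assumes "lam > 0" "m > 0" "s > 0" "a \<ge> 0" "0 \<le> p" "p \<le> q"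
  shows "best_response lam m s a q \<le> best_response lam m s a p"
proof -
  define u where "u r = max 0 (1 - lam * r * m)" for r
  define v where "v r = lam * r * s" for r
  have "u q \<le> u p" "0 \<le> u q" "v p \<le> v q" "0 \<le> v p"
    using assms
    by (auto simp: u_def v_def intro!: max.mono diff_mono mult_right_mono mult_left_mono
        simp del: max.bounded_iff)
  \<comment> \<open>Once the two quotients are cross-multiplied, the terms
    \<open>2 * m * u p * u q\<close> cancel and only this inequality is left to prove.\<close>
  then have "u q * v p \<le> u p * v q"
    by (intro mult_mono) auto
  then have "u q * (v p + 2 * m * u p) \<le> u p * (v q + 2 * m * u q)"
    by (simp add: algebra_simps)
  then have "a * (u q * (v p + 2 * m * u p)) \<le> a * (u p * (v q + 2 * m * u q))"
    using assms by (intro mult_left_mono)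
  moreover have "v p + 2 * m * u p > 0" "v q + 2 * m * u q > 0"
    using best_response_denominator_pos[of lam m s] assms by (auto simp: u_def v_def)
  ultimately have "a * u q / (v q + 2 * m * u q) \<le> a * u p / (v p + 2 * m * u p)"
    by (simp add: divide_simps mult_ac)
  then show ?thesis
    unfolding best_response_def u_def v_def by (intro min.mono) auto
qed

lemma ex1_fixed_point_best_response:
  assumes "lam > 0" "m > 0" "s > 0" "a \<ge> 0"
  shows "\<exists>!p. p \<in> {0..1} \<and> p = best_response lam m s a p"
proof -
  let ?b = "best_response lam m s a"
  have "\<exists>p. 0 \<le> p \<and> p \<le> 1 \<and> p - ?b p = 0"
  proof (rule IVT')
    show "continuous_on {0..1} (\<lambda>p. p - ?b p)"
      by (intro continuous_intros continuous_on_best_response assms)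
  \<comment> \<open>The signs at the endpoints: \<open>?b 0 \<ge> 0\<close> because
    \<open>a \<ge> 0\<close>, and \<open>?b 1 \<le> 1\<close> because of the
    \<open>min\<close>.\<close>
  qed (use assms in \<open>auto simp: best_response_def\<close>)
  moreover have "p = q" if "0 \<le> p" "0 \<le> q" "p = ?b p" "q = ?b q" for p q
  proof (cases "p \<le> q")
    case True
    then show ?thesis using best_response_antimono[OF assms, of p q] that by linarith
  next
    case False
    then show ?thesis using best_response_antimono[OF assms, of q p] that by linarith
  qed
  ultimately show ?thesis by auto
qed

context
  fixes M :: "'w measure" and S :: "'w \<Rightarrow> real" and lam :: real
  assumes lam_pos: "lam > 0"
    and mean_pos: "integral\<^sup>L M S > 0"
    and sq_mean_pos: "integral\<^sup>L M (\<lambda>\<omega>. (S \<omega>)\<^sup>2) > 0"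
begin

lemma mean_delay_finite:
  assumes "p \<ge> 0" "lam * p * integral\<^sup>L M S < 1"
  obtains t where "mean_delay M S lam p = ereal t" "t > 0"
    "t = (lam * p * integral\<^sup>L M (\<lambda>\<omega>. (S \<omega>)\<^sup>2) + 2 * integral\<^sup>L M S * (1 - lam * p * integral\<^sup>L M S))
       / (2 * (1 - lam * p * integral\<^sup>L M S))"
proof -
  let ?m = "integral\<^sup>L M S" and ?s = "integral\<^sup>L M (\<lambda>\<omega>. (S \<omega>)\<^sup>2)"
  let ?t = "lam * p * ?s / (2 * (1 - lam * p * ?m)) + ?m"
  have "mean_delay M S lam p = ereal ?t"
    using assms mean_pos by (simp add: mean_delay_def field_simps)
  moreover have "?t > 0"
    using assms lam_pos mean_pos sq_mean_pos by (intro add_nonneg_pos) auto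
  moreover have "?t = (lam * p * ?s + 2 * ?m * (1 - lam * p * ?m)) / (2 * (1 - lam * p * ?m))"
    using assms by (subst add_divide_distrib) (simp add: divide_simps)
  ultimately show ?thesis by (rule that)
qed

lemma mean_delay_infinite:
  assumes "lam * p * integral\<^sup>L M S \<ge> 1"
  shows "mean_delay M S lam p = \<infinity>"
  using assms mean_pos by (simp add: mean_delay_def field_simps)

text \<open>Inverting the delay, written as a single fraction, produces the quotient in
  \<open>best_response\<close>. If the delay is infinite, both sides are 0.\<close>

lemma type_cdf_join_threshold:
  assumes "\<theta>up > 0" "p \<ge> 0"
  shows "type_cdf \<theta>up (join_threshold V c (mean_delay M S lam) p) =
    best_response lam (integral\<^sup>L M S) (integral\<^sup>L M (\<lambda>\<omega>. (S \<omega>)\<^sup>2)) (2 * max 0 (V - c) / \<theta>up) p"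
proof (cases "lam * p * integral\<^sup>L M S < 1")
  case True
  let ?m = "integral\<^sup>L M S" and ?s = "integral\<^sup>L M (\<lambda>\<omega>. (S \<omega>)\<^sup>2)"
  define w where "w = 1 - lam * p * ?m"
  define d where "d = lam * p * ?s + 2 * ?m * w"
  have w: "w > 0" "max 0 w = w" using True by (auto simp: w_def)
  have d: "d > 0"
    using best_response_denominator_pos[OF lam_pos mean_pos sq_mean_pos assms(2)] w
    by (simp add: d_def w_def)
  obtain t where t: "mean_delay M S lam p = ereal t" "t > 0" "t = d / (2 * w)"
    using mean_delay_finite[OF assms(2) True] unfolding w_def d_def by metis
  have "join_threshold V c (mean_delay M S lam) p = (V - c) / t"
    using t by (simp add: join_threshold_def)
  also have "\<dots> = 2 * w * (V - c) / d"
    using w t by simp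
  finally have "join_threshold V c (mean_delay M S lam) p / \<theta>up = 2 * w / (d * \<theta>up) * (V - c)"
    by simp
  \<comment> \<open>The factor in front of \<open>V - c\<close> is positive, so the truncation of
    the distribution function at 0 passes to \<open>V - c\<close>.\<close>
  moreover have "max 0 (2 * w / (d * \<theta>up) * (V - c)) = 2 * w / (d * \<theta>up) * max 0 (V - c)"
    using w d assms(1) by (simp add: max_mult_distrib_left)
  ultimately have "max 0 (join_threshold V c (mean_delay M S lam) p / \<theta>up)
      = 2 * max 0 (V - c) / \<theta>up * w / d"
    by (simp add: mult_ac)
  then show ?thesis
    using assms w by (simp add: type_cdf_eq best_response_def w_def d_def)
next
  case False
  then show ?thesis
    using assms
    by (simp add: type_cdf_eq best_response_def join_threshold_def mean_delay_infinite)
qed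

lemma ex1_nash_equilibrium:
  assumes "\<theta>up > 0"
  shows "\<exists>!p. nash_equilibrium \<theta>up V c (mean_delay M S lam) p"
proof -
  have "nash_equilibrium \<theta>up V c (mean_delay M S lam) = (\<lambda>p. p \<in> {0..1} \<and>
      p = best_response lam (integral\<^sup>L M S) (integral\<^sup>L M (\<lambda>\<omega>. (S \<omega>)\<^sup>2)) (2 * max 0 (V - c) / \<theta>up) p)"
    using type_cdf_join_threshold[OF assms] by (auto simp: nash_equilibrium_def fun_eq_iff)
  then show ?thesis
    using ex1_fixed_point_best_response[OF lam_pos mean_pos sq_mean_pos] assms by simp
qed

text \<open>Optimality could fail at an infinite delay: since \<open>0 * \<infinity> = 0\<close> on
  \<open>ereal\<close>, type 0 would gain \<open>V - c\<close> by joining, while the threshold 0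
  tells it to balk.\<close>

lemma nash_equilibrium_finite_delay:
  assumes "\<theta>up > 0" "nash_equilibrium \<theta>up V c (mean_delay M S lam) p"
  obtains t where "mean_delay M S lam p = ereal t" "t > 0"
proof -
  have p: "p \<ge> 0" "p = type_cdf \<theta>up (join_threshold V c (mean_delay M S lam) p)"
    using assms by (auto simp: nash_equilibrium_def)
  have "lam * p * integral\<^sup>L M S < 1"
  proof (rule ccontr)
    assume *: "\<not> lam * p * integral\<^sup>L M S < 1"
    then have "p = 0"
      using p(2) assms(1) by (simp add: type_cdf_eq join_threshold_def mean_delay_infinite)
    with * show False by simp
  qed
  then show ?thesis
    using mean_delay_finite[OF p(1)] that by metis
qed

end

text \<open>Expected utility is linear in \<open>q\<close>, so an endpoint of the unit interval is
  optimal, chosen by the sign of \<open>V - \<theta> * t - c\<close>; as \<open>t > 0\<close>, this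
  sign is positive exactly below the threshold.\<close>

lemma optimal_strategy_optimal:
  assumes "T p = ereal t" "t > 0" "q \<in> {0..1}"
  shows "expected_utility V c T p \<theta> q \<le> expected_utility V c T p \<theta> (optimal_strategy V c T p \<theta>)"
proof -
  have util: "expected_utility V c T p \<theta> r = ereal (r * (V - \<theta> * t - c))" for r
    using assms by (simp add: expected_utility_def join_utility_def)
  have strat: "optimal_strategy V c T p \<theta> = (if V - \<theta> * t - c > 0 then 1 else 0)"
    using assms by (auto simp: optimal_strategy_def join_threshold_def field_simps)
  show ?thesis
    unfolding util strat using assms(3)
    by (auto simp: mult_le_cancel_right1 mult_nonneg_nonpos)
qed

theorem theorem1:
  fixes M :: "'w measure"
    and X :: "'w \<Rightarrow> real" and Y :: "nat \<Rightarrow> 'w \<Rightarrow> real"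
    and R :: "'w \<Rightarrow> real" and Z :: "nat \<Rightarrow> 'w \<Rightarrow> real"
    and lam V \<theta>up c1 :: real and T :: "real \<Rightarrow> ereal"
  assumes "shared_use_channel M X Y R Z"
    and "lam > 0" and "V > 0" and "\<theta>up > 0" and "c1 \<ge> 0"
    and T_def: "T = mean_delay M (effective_service_time X Y R Z) lam"
  shows "(\<exists>!p. nash_equilibrium \<theta>up V c1 T p) \<and>
    (\<forall>p. nash_equilibrium \<theta>up V c1 T p \<longrightarrow>
      (\<forall>\<theta>\<in>{0..\<theta>up}. \<forall>q\<in>{0..1}.
        expected_utility V c1 T p \<theta> q
          \<le> expected_utility V c1 T p \<theta> (optimal_strategy V c1 T p \<theta>)))"
proof -
  interpret shared_use_channel M X Y R Z by fact
  note channel = \<open>lam > 0\<close> Xe_mean_pos Xe_sq_mean_pos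
  show ?thesis
    unfolding T_def
    by (metis ex1_nash_equilibrium[OF channel \<open>\<theta>up > 0\<close>]
        nash_equilibrium_finite_delay[OF channel \<open>\<theta>up > 0\<close>] optimal_strategy_optimal)
qed

end
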